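(* Consider the system $x_{k+1}=F_kx_k+G_kx_kw_k$, $y_k=H_kx_k$, $k=0,1,2,\dots$. (i) For an integer $N\ge0$, the system is $\mathcal K^{N}$-exactly observable if and only if for any $k\in\mathcal N_0$ the Gramian $\mathcal O_{k+N,k}$ is a positive definite matrix. (ii) If the system is $\mathcal K^{WFT}$-exactly observable and $\{P_k\ge 0\}_{k\ge 0}$ solves the generalized Lyapunov equation $$-P_k+F_k^TP_{k+1}F_k+G_k^TP_{k+1}G_k+H_k^TH_k=0,\qquad k=0,1,2,\dots,$$ then $P_k>0$ for any $k\ge 0$.
   Context: $\{w_k\}_{k\ge 0}$ is a one-dimensional independent white noise process on a probability space, with $E w_k=0$, $E[w_kw_j]=\delta_{kj}$; $\mathcal F_k=\sigma(w_0,\dots,w_k)$ and $\mathcal F_{-1}$ is the trivial sigma-algebra; $l^2_{\mathcal F_k}$ is the set of $\mathcal F_k$-measurable random vectors $x$ with $E\|x\|^2<\infty$. $\mathcal N_0=\{0,1,2,\dots\}$. $F_k,G_k\in\mathbb R^{n\times n}$, $H_k\in\mathbb R^{m\times n}$ are deterministic real matrices; $x_k\in\mathbb R^n$, $y_k\in\mathbb R^m$. $A>0$ (resp. $A\ge0$) means real symmetric positive definite (resp. semi-definite). Define $\phi_{k,k}=I$ and, for $l>k$, $\phi_{l,k}=\begin{bmatrix}\phi_{l,k+1}F_k\\ \phi_{l,k+1}G_k\end{bmatrix}$. For $l\ge k\ge0$ define $H_{k,k}=H_k$ and $$H_{l,k}=\begin{bmatrix}H_k\\ (I_2\otimes H_{k+1})\phi_{k+1,k}\\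 (I_{2^2}\otimes H_{k+2})\phi_{k+2,k}\\ \vdots\\ (I_{2^{l-k}}\otimes H_l)\phi_{l,k}\end{bmatrix},$$ and the Gramian $\mathcal O_{k+s,k}=H_{k+s,k}^TH_{k+s,k}$. A state $x_{k_0}\in l^2_{\mathcal F_{k_0-1}}$ at time $k_0$ is $k_0^{s_0}$-unobservable if the output generated from it satisfies $y_k=0$ a.s. for all $k\in[k_0,k_0+s_0]$. The system is $k_0^{s_0}$-exactly observable if $x_{k_0}=0$ (a.s.) is the unique $k_0^{s_0}$-unobservable state. For an integer $N\ge0$, the system is $\mathcal K^N$-exactly observable if it is $k^N$-exactly observable for every time $k\ge 0$. It is $\mathcal K^{WFT}$-exactly observable (weakly finite time) if there exists a nonnegative integer sequence $\{s_k\}_{k\ge0}$ with $\limsup_{k\to\infty}s_k=+\infty$ such that the system is $k^{s_k}$-exactly observable for every $k\ge0$. *)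

theory Defs
  imports "HOL-Probability.Probability" "Jordan_Normal_Form.Matrix"
begin

text \<open>
  The matrices \<open>\<phi>\<^sub>l\<^sub>,\<^sub>k\<close> and \<open>H\<^sub>l\<^sub>,\<^sub>k\<close> have a number of rows that grows with \<open>l\<close>, so all matrices
  and vectors are those of \<^theory>\<open>Jordan_Normal_Form.Matrix\<close>, with explicit dimensions.  Since
  \<^theory>\<open>HOL-Probability.Probability\<close> brings in types of the same names, the types are qualified
  and \<^const>\<open>vec_index\<close>, \<^const>\<open>scalar_prod\<close> are written in prefix form.
\<close>

definition pos_semidef :: "nat \<Rightarrow> real Matrix.mat \<Rightarrow> bool" where
  "pos_semidef n A \<longleftrightarrow> A \<in> carrier_mat n n \<and> transpose_mat A = A \<and>
     (\<forall>v \<in> carrier_vec n. 0 \<le> scalar_prod v (A *\<^sub>v v))"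

definition pos_def :: "nat \<Rightarrow> real Matrix.mat \<Rightarrow> bool" where
  "pos_def n A \<longleftrightarrow> A \<in> carrier_mat n n \<and> transpose_mat A = A \<and>
     (\<forall>v \<in> carrier_vec n. v \<noteq> 0\<^sub>v n \<longrightarrow> 0 < scalar_prod v (A *\<^sub>v v))"

definition kronecker :: "real Matrix.mat \<Rightarrow> real Matrix.mat \<Rightarrow> real Matrix.mat"  (infixl "\<otimes>\<^sub>K" 70) where
  "A \<otimes>\<^sub>K B = Matrix.mat (dim_row A * dim_row B) (dim_col A * dim_col B)
     (\<lambda>(i, j). A $$ (i div dim_row B, j div dim_col B) * B $$ (i mod dim_row B, j mod dim_col B))"


text \<open>\<open>phi n F G l k\<close> is \<open>\<phi>\<^sub>l\<^sub>,\<^sub>k\<close>, of size \<open>2\<^sup>l\<^sup>-\<^sup>k n \<times> n\<close>; only arguments with \<open>l \<ge> k\<close> are meaningful.\<close>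

function phi :: "nat \<Rightarrow> (nat \<Rightarrow> real Matrix.mat) \<Rightarrow> (nat \<Rightarrow> real Matrix.mat) \<Rightarrow>
    nat \<Rightarrow> nat \<Rightarrow> real Matrix.mat" where
  "phi n F G l k =
     (if l \<le> k then 1\<^sub>m n
      else (phi n F G l (Suc k) * F k) @\<^sub>r (phi n F G l (Suc k) * G k))"
  by pat_completeness auto
termination by (relation "Wellfounded.measure (\<lambda>(n, F, G, l, k). l - k)") auto

declare phi.simps [simp del]

text \<open>\<open>obs_matrix n F G H l k\<close> is \<open>H\<^sub>l\<^sub>,\<^sub>k\<close>, for \<open>l \<ge> k\<close>.\<close>

definition obs_matrix :: "nat \<Rightarrow> (nat \<Rightarrow> real Matrix.mat) \<Rightarrow> (nat \<Rightarrow> real Matrix.mat) \<Rightarrow>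
    (nat \<Rightarrow> real Matrix.mat) \<Rightarrow> nat \<Rightarrow> nat \<Rightarrow> real Matrix.mat" where
  "obs_matrix n F G H l k =
     foldl (@\<^sub>r) (H k) (map (\<lambda>j. (1\<^sub>m (2 ^ (j - k)) \<otimes>\<^sub>K H j) * phi n F G j k) [Suc k..<Suc l])"

definition gramian :: "nat \<Rightarrow> (nat \<Rightarrow> real Matrix.mat) \<Rightarrow> (nat \<Rightarrow> real Matrix.mat) \<Rightarrow>
    (nat \<Rightarrow> real Matrix.mat) \<Rightarrow> nat \<Rightarrow> nat \<Rightarrow> real Matrix.mat" where
  "gramian n F G H l k = transpose_mat (obs_matrix n F G H l k) * obs_matrix n F G H l k"


text \<open>
  The normalisation \<open>E[w\<^sub>k\<^sup>2] = 1 \<noteq> 0\<close> forces \<open>w\<^sub>k\<^sup>2\<close>, hence \<open>w\<^sub>k\<close> and \<open>w\<^sub>k w\<^sub>j\<close>, to be integrable, so no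
  expectation below takes the default value of a non-integrable function.
\<close>

definition white_noise :: "'a measure \<Rightarrow> (nat \<Rightarrow> 'a \<Rightarrow> real) \<Rightarrow> bool" where
  "white_noise M w \<longleftrightarrow>
     prob_space.indep_vars M (\<lambda>_. borel) w UNIV \<and>
     (\<forall>k. (LINT \<omega>|M. w k \<omega>) = 0) \<and>
     (\<forall>k j. (LINT \<omega>|M. w k \<omega> * w j \<omega>) = (if k = j then 1 else 0))"

text \<open>
  The index is shifted by one: \<open>past M w k\<close> is \<open>\<F>\<^sub>k\<^sub>-\<^sub>1 = \<sigma>(w\<^sub>0, \<dots>, w\<^sub>k\<^sub>-\<^sub>1)\<close>, so that \<open>past M w 0\<close> is the
  trivial sigma-algebra \<open>\<F>\<^sub>-\<^sub>1\<close>.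
\<close>

definition past :: "'a measure \<Rightarrow> (nat \<Rightarrow> 'a \<Rightarrow> real) \<Rightarrow> nat \<Rightarrow> 'a measure" where
  "past M w k = sigma (space M) {w j -` B \<inter> space M | j B. j < k \<and> B \<in> sets borel}"

text \<open>\<open>l2_past M w n k\<close> is the set of \<open>n\<close>-dimensional random vectors in \<open>l\<^sup>2\<close> over \<open>\<F>\<^sub>k\<^sub>-\<^sub>1\<close>.\<close>

definition l2_past :: "'a measure \<Rightarrow> (nat \<Rightarrow> 'a \<Rightarrow> real) \<Rightarrow> nat \<Rightarrow> nat \<Rightarrow> ('a \<Rightarrow> real Matrix.vec) set" where
  "l2_past M w n k = {x.
     (\<forall>\<omega> \<in> space M. x \<omega> \<in> carrier_vec n) \<and>
     (\<forall>i < n. (\<lambda>\<omega>. vec_index (x \<omega>) i) \<in> borel_measurable (past M w k)) \<and>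
     integrable M (\<lambda>\<omega>. scalar_prod (x \<omega>) (x \<omega>))}"

text \<open>
  \<open>trajectory F G w k0 x k\<close> is the state at time \<open>k\<close> of the system started at time \<open>k0\<close> in \<open>x\<close>; it is
  meaningful for \<open>k \<ge> k0\<close> and takes the constant value \<open>x\<close> before.
\<close>

primrec trajectory :: "(nat \<Rightarrow> real Matrix.mat) \<Rightarrow> (nat \<Rightarrow> real Matrix.mat) \<Rightarrow> (nat \<Rightarrow> 'a \<Rightarrow> real) \<Rightarrow>
    nat \<Rightarrow> ('a \<Rightarrow> real Matrix.vec) \<Rightarrow> nat \<Rightarrow> 'a \<Rightarrow> real Matrix.vec" where
  "trajectory F G w k0 x 0 = x"
| "trajectory F G w k0 x (Suc k) =
     (if k < k0 then x
      else (\<lambda>\<omega>. F k *\<^sub>v trajectory F G w k0 x k \<omega>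
                + w k \<omega> \<cdot>\<^sub>v (G k *\<^sub>v trajectory F G w k0 x k \<omega>)))"

definition unobservable :: "'a measure \<Rightarrow> (nat \<Rightarrow> 'a \<Rightarrow> real) \<Rightarrow> nat \<Rightarrow> nat \<Rightarrow> (nat \<Rightarrow> real Matrix.mat) \<Rightarrow>
    (nat \<Rightarrow> real Matrix.mat) \<Rightarrow> (nat \<Rightarrow> real Matrix.mat) \<Rightarrow> nat \<Rightarrow> nat \<Rightarrow> ('a \<Rightarrow> real Matrix.vec) \<Rightarrow> bool" where
  "unobservable M w n m F G H k0 s0 x \<longleftrightarrow>
     x \<in> l2_past M w n k0 \<and>
     (\<forall>k \<in> {k0..k0 + s0}. AE \<omega> in M. H k *\<^sub>v trajectory F G w k0 x k \<omega> = 0\<^sub>v m)"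

text \<open>Uniqueness of the unobservable state is up to almost sure equality.\<close>

definition exactly_observable_at :: "'a measure \<Rightarrow> (nat \<Rightarrow> 'a \<Rightarrow> real) \<Rightarrow> nat \<Rightarrow> nat \<Rightarrow>
    (nat \<Rightarrow> real Matrix.mat) \<Rightarrow> (nat \<Rightarrow> real Matrix.mat) \<Rightarrow> (nat \<Rightarrow> real Matrix.mat) \<Rightarrow> nat \<Rightarrow> nat \<Rightarrow> bool" where
  "exactly_observable_at M w n m F G H k0 s0 \<longleftrightarrow>
     (\<forall>x \<in> l2_past M w n k0.
        unobservable M w n m F G H k0 s0 x \<longleftrightarrow> (AE \<omega> in M. x \<omega> = 0\<^sub>v n))"

definition KN_exactly_observable :: "'a measure \<Rightarrow> (nat \<Rightarrow> 'a \<Rightarrow> real) \<Rightarrow> nat \<Rightarrow> nat \<Rightarrow>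
    (nat \<Rightarrow> real Matrix.mat) \<Rightarrow> (nat \<Rightarrow> real Matrix.mat) \<Rightarrow> (nat \<Rightarrow> real Matrix.mat) \<Rightarrow> nat \<Rightarrow> bool" where
  "KN_exactly_observable M w n m F G H N \<longleftrightarrow> (\<forall>k. exactly_observable_at M w n m F G H k N)"

definition KWFT_exactly_observable :: "'a measure \<Rightarrow> (nat \<Rightarrow> 'a \<Rightarrow> real) \<Rightarrow> nat \<Rightarrow> nat \<Rightarrow>
    (nat \<Rightarrow> real Matrix.mat) \<Rightarrow> (nat \<Rightarrow> real Matrix.mat) \<Rightarrow> (nat \<Rightarrow> real Matrix.mat) \<Rightarrow> bool" where
  "KWFT_exactly_observable M w n m F G H \<longleftrightarrow>
     (\<exists>s :: nat \<Rightarrow> nat. limsup (\<lambda>k. ereal (real (s k))) = \<infinity> \<and>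
        (\<forall>k. exactly_observable_at M w n m F G H k (s k)))"

end

theory Submission
  imports Defs
begin

text \<open>
  Everything rests on the kernel \<open>K\<^sub>s\<^sub>,\<^sub>k = {v. H\<^sub>k\<^sub>+\<^sub>s\<^sub>,\<^sub>k v = 0}\<close> of the observability matrix.  Unfolding the
  block structure of \<open>\<phi>\<close> shows that it satisfies a recursion (\<open>obs_matrix_Suc\<close>): a vector \<open>v\<close> lies in
  \<open>K\<^sub>s\<^sub>+\<^sub>1\<^sub>,\<^sub>k\<close> iff \<open>H\<^sub>k v = 0\<close> and both \<open>F\<^sub>k v\<close> and \<open>G\<^sub>k v\<close> lie in \<open>K\<^sub>s\<^sub>,\<^sub>k\<^sub>+\<^sub>1\<close>.

  Unobservable states obey the same recursion.  The next state is \<open>F\<^sub>k x + w\<^sub>k G\<^sub>k x\<close>, where \<open>w\<^sub>k\<close> has mean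
  zero and variance one and is independent of \<open>x\<close>.  So for every linear functional \<open>c\<close>,
  \<open>E[(c F\<^sub>k x + w\<^sub>k c G\<^sub>k x)\<^sup>2] = E[(c F\<^sub>k x)\<^sup>2] + E[(c G\<^sub>k x)\<^sup>2]\<close>; if a functional vanishes almost surely on
  the next state, it vanishes almost surely on \<open>F\<^sub>k x\<close> and on \<open>G\<^sub>k x\<close> (\<open>noise_separates\<close>).  Hence \<open>x\<close> is
  unobservable on \<open>[k, k + s]\<close> iff \<open>x \<in> K\<^sub>s\<^sub>,\<^sub>k\<close> almost surely (\<open>unobservable_iff\<close>).  Constant random states
  then show that exact observability means that \<open>K\<^sub>s\<^sub>,\<^sub>k\<close> is trivial (\<open>exactly_observable_iff\<close>), and since
  \<open>v \<bullet> H\<^sup>T H v = H v \<bullet> H v\<close>, this is positive definiteness of the Gramian.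

  For the Lyapunov equation, evaluate it as a quadratic form at \<open>v\<close>:
  \<open>v \<bullet> P\<^sub>k v = F\<^sub>k v \<bullet> P\<^sub>k\<^sub>+\<^sub>1 F\<^sub>k v + G\<^sub>k v \<bullet> P\<^sub>k\<^sub>+\<^sub>1 G\<^sub>k v + H\<^sub>k v \<bullet> H\<^sub>k v\<close>, with all terms nonnegative.  If the left side
  vanishes, so does each term on the right, and by the recursion \<open>v \<in> K\<^sub>s\<^sub>,\<^sub>k\<close> for every \<open>s\<close>
  (\<open>lyapunov_null_vector_unobserved\<close>).  Observability at \<open>k\<close> over some finite horizon makes this
  kernel trivial, so \<open>v = 0\<close>.
\<close>

section \<open>Kernels of block diagonal matrices\<close>

text \<open>
  The matrix \<open>I\<^sub>r \<otimes> B\<close> is block diagonal: it cuts a vector into \<open>r\<close> blocks of length \<open>n\<close> and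
  applies \<open>B\<close> to each block separately.  Row \<open>b * m + i\<close> is row \<open>i\<close> of the \<open>b\<close>-th block.
\<close>

lemma kronecker_one_mult_vec_index:
  assumes B: "B \<in> carrier_mat m n" and u: "u \<in> carrier_vec (r * n)"
    and b: "b < r" and i: "i < m"
  shows "vec_index ((1\<^sub>m r \<otimes>\<^sub>K B) *\<^sub>v u) (b * m + i)
    = vec_index (B *\<^sub>v Matrix.vec n (\<lambda>j. vec_index u (b * n + j))) i"
proof -
  have bi: "b * m + i < r * m"
  proof -
    have "b * m + i < Suc b * m" using i by simp
    also have "\<dots> \<le> r * m" using b by (intro mult_le_mono) auto
    finally show ?thesis .
  qed
  have im: "(b * m + i) div m = b" "(b * m + i) mod m = i" using i by auto
  let ?g = "\<lambda>j. (1\<^sub>m r \<otimes>\<^sub>K B) $$ (b * m + i, j) * vec_index u j"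
  have "vec_index ((1\<^sub>m r \<otimes>\<^sub>K B) *\<^sub>v u) (b * m + i) = (\<Sum>j<r * n. ?g j)"
    using B u bi by (auto simp: kronecker_def scalar_prod_def lessThan_atLeast0 intro!: sum.cong)
  also have "\<dots> = (\<Sum>c<r. sum ?g {c * n..<c * n + n})" by (rule sum.nat_group[symmetric])
  also have "\<dots> = (\<Sum>c<r. \<Sum>j<n. ?g (c * n + j))"
    using sum.shift_bounds_nat_ivl[of ?g 0 "c * n" n for c]
    by (simp add: lessThan_atLeast0 add.commute)
  also have "\<dots> = (\<Sum>c<r. if c = b then \<Sum>j<n. B $$ (i, j) * vec_index u (b * n + j) else 0)"
  proof (intro sum.cong refl)
    fix c assume c: "c \<in> {..<r}"
    have "(1\<^sub>m r \<otimes>\<^sub>K B) $$ (b * m + i, c * n + j) = (if c = b then B $$ (i, j) else 0)"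
      if "j < n" for j
    proof -
      have "c * n + j < Suc c * n" using that by simp
      also have "\<dots> \<le> r * n" using c by (intro mult_le_mono) auto
      finally show ?thesis using that B b c bi im by (auto simp: kronecker_def)
    qed
    thus "(\<Sum>j<n. ?g (c * n + j)) =
        (if c = b then \<Sum>j<n. B $$ (i, j) * vec_index u (b * n + j) else 0)" by auto
  qed
  also have "\<dots> = (\<Sum>j<n. B $$ (i, j) * vec_index u (b * n + j))" using b by simp
  also have "\<dots> = vec_index (B *\<^sub>v Matrix.vec n (\<lambda>j. vec_index u (b * n + j))) i"
    using B i by (auto simp: scalar_prod_def lessThan_atLeast0 intro!: sum.cong)
  finally show ?thesis .
qed

lemma kronecker_one_mult_vec_eq_0_iff:
  assumes B: "B \<in> carrier_mat m n" and u: "u \<in> carrier_vec (r * n)"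
  shows "(1\<^sub>m r \<otimes>\<^sub>K B) *\<^sub>v u = 0\<^sub>v (r * m) \<longleftrightarrow>
    (\<forall>b<r. B *\<^sub>v Matrix.vec n (\<lambda>j. vec_index u (b * n + j)) = 0\<^sub>v m)"
    (is "?L = 0\<^sub>v _ \<longleftrightarrow> ?R")
proof -
  have d: "dim_vec ?L = r * m" using B by (simp add: kronecker_def)
  have lt: "b * m + i < r * m" if "b < r" "i < m" for b i
  proof -
    have "b * m + i < Suc b * m" using that by simp
    also have "\<dots> \<le> r * m" using that by (intro mult_le_mono) auto
    finally show ?thesis .
  qed
  have "?L = 0\<^sub>v (r * m) \<longleftrightarrow> (\<forall>b<r. \<forall>i<m. vec_index ?L (b * m + i) = 0)"
  proof
    assume "?L = 0\<^sub>v (r * m)"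
    thus "\<forall>b<r. \<forall>i<m. vec_index ?L (b * m + i) = 0" using lt by auto
  next
    assume *: "\<forall>b<r. \<forall>i<m. vec_index ?L (b * m + i) = 0"
    show "?L = 0\<^sub>v (r * m)"
    proof (rule eq_vecI)
      fix p assume "p < dim_vec (0\<^sub>v (r * m) :: real Matrix.vec)"
      hence p: "p < r * m" by simp
      hence "m > 0" by (cases m) auto
      hence "vec_index ?L (p div m * m + p mod m) = 0"
        using p * less_mult_imp_div_less[OF p] mod_less_divisor by blast
      hence "vec_index ?L p = 0" by (simp only: div_mult_mod_eq)
      thus "vec_index ?L p = vec_index (0\<^sub>v (r * m)) p" using p by simp
    qed (use d in auto)
  qed
  also have "\<dots> \<longleftrightarrow> ?R"
    using B by (simp add: kronecker_one_mult_vec_index[OF B u] vec_eq_iff del: index_mult_mat_vec)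
  finally show ?thesis .
qed

lemma kronecker_one_one: "1\<^sub>m 1 \<otimes>\<^sub>K B = B"
  by (rule eq_matI) (auto simp: kronecker_def)

text \<open>
  This is what lets the two halves of \<open>\<phi>\<^sub>l\<^sub>,\<^sub>k v\<close>, the one through \<open>F\<^sub>k\<close> and the one through \<open>G\<^sub>k\<close>,
  be treated separately: the blocks of a concatenation are those of its first half followed by
  those of its second half.
\<close>

lemma kronecker_one_append_eq_0_iff:
  assumes B: "B \<in> carrier_mat m n" and u: "u \<in> carrier_vec (r * n)" and v: "v \<in> carrier_vec (r * n)"
  shows "(1\<^sub>m (2 * r) \<otimes>\<^sub>K B) *\<^sub>v (u @\<^sub>v v) = 0\<^sub>v (2 * r * m) \<longleftrightarrow>
    (1\<^sub>m r \<otimes>\<^sub>K B) *\<^sub>v u = 0\<^sub>v (r * m) \<and> (1\<^sub>m r \<otimes>\<^sub>K B) *\<^sub>v v = 0\<^sub>v (r * m)"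
proof -
  have uv: "u @\<^sub>v v \<in> carrier_vec (2 * r * n)" 
    using append_carrier_vec[OF u v] by (simp only: mult_2 add_mult_distrib)
  let ?blk = "\<lambda>x b. Matrix.vec n (\<lambda>j. vec_index x (b * n + j))"
  have lt: "b * n + i < r * n" if "b < r" "i < n" for b i
  proof -
    have "b * n + i < Suc b * n" using that by simp
    also have "\<dots> \<le> r * n" using that by (intro mult_le_mono) auto
    finally show ?thesis .
  qed
  have 1: "?blk (u @\<^sub>v v) b = ?blk u b" if "b < r" for b
  proof (rule eq_vecI)
    fix i assume "i < dim_vec (?blk u b)"
    hence i: "i < n" by simp
    show "vec_index (?blk (u @\<^sub>v v) b) i = vec_index (?blk u b) i"
      using lt[OF that i] u v i by simp
  qed simp
  have 2: "?blk (u @\<^sub>v v) (r + b) = ?blk v b" if "b < r" for b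
  proof (rule eq_vecI)
    fix i assume "i < dim_vec (?blk v b)"
    hence i: "i < n" by simp
    show "vec_index (?blk (u @\<^sub>v v) (r + b)) i = vec_index (?blk v b) i"
      using lt[OF that i] u v i by (simp add: add_mult_distrib)
  qed simp
  have split: "(\<forall>b<2 * r. P b) \<longleftrightarrow> (\<forall>b<r. P b) \<and> (\<forall>b<r. P (r + b))" for P :: "nat \<Rightarrow> bool"
  proof (intro iffI conjI allI impI)
    fix b assume *: "(\<forall>b<r. P b) \<and> (\<forall>b<r. P (r + b))" and b: "b < 2 * r"
    show "P b"
    proof (cases "b < r")
      case False
      with b have "b - r < r" "r + (b - r) = b" by auto
      with * show ?thesis by metis
    qed (use * in auto)
  qed auto
  show ?thesis
    unfolding kronecker_one_mult_vec_eq_0_iff[OF B uv] kronecker_one_mult_vec_eq_0_iff[OF B u]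
      kronecker_one_mult_vec_eq_0_iff[OF B v] split
    using 1 2 by simp
qed

section \<open>Kernels of stacked matrices and of the observability matrix\<close>

text \<open>
  A form of \<open>A *\<^sub>v v = 0\<close> that does not mention the number of rows, which for the observability
  matrices is a sum over all stages of powers of two times \<open>m\<close>.
\<close>

abbreviation annihilates :: "real Matrix.mat \<Rightarrow> real Matrix.vec \<Rightarrow> bool" where
  "annihilates A v \<equiv> A *\<^sub>v v = 0\<^sub>v (dim_row A)"

lemma annihilates_append_rows:
  assumes "dim_col A = n" "dim_col B = n" "v \<in> carrier_vec n"
  shows "annihilates (A @\<^sub>r B) v \<longleftrightarrow> annihilates A v \<and> annihilates B v"
proof -
  have A: "A \<in> carrier_mat (dim_row A) n" and B: "B \<in> carrier_mat (dim_row B) n"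
    using assms by auto
  have d: "dim_row (A @\<^sub>r B) = dim_row A + dim_row B"
    using carrier_append_rows[OF A B] by (rule carrier_matD)
  have z: "0\<^sub>v (p + q) = 0\<^sub>v p @\<^sub>v (0\<^sub>v q :: real Matrix.vec)" for p q by (intro eq_vecI) auto
  show ?thesis
    unfolding d z mat_mult_append[OF A B assms(3)]
    by (rule append_vec_eq[OF mult_mat_vec_carrier[OF A assms(3)] zero_carrier_vec])
qed

lemma annihilates_foldl_append_rows:
  assumes "dim_col A = n" "\<forall>B \<in> set Bs. dim_col B = n"
  shows "dim_col (foldl (@\<^sub>r) A Bs) = n \<and> (\<forall>v \<in> carrier_vec n.
    annihilates (foldl (@\<^sub>r) A Bs) v \<longleftrightarrow> annihilates A v \<and> (\<forall>B \<in> set Bs. annihilates B v))"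
  using assms
proof (induction Bs arbitrary: A)
  case Nil
  thus ?case by simp
next
  case (Cons B Bs)
  have cols: "dim_col B = n" "\<forall>B \<in> set Bs. dim_col B = n"
    using Cons.prems(2) by auto
  hence "dim_col (A @\<^sub>r B) = n"
    using Cons.prems(1) carrier_append_rows[of A "dim_row A" n B "dim_row B"] by blast
  note IH = Cons.IH[OF this cols(2)]
  have "annihilates (foldl (@\<^sub>r) A (B # Bs)) v \<longleftrightarrow>
      annihilates A v \<and> (\<forall>B \<in> set (B # Bs). annihilates B v)" if v: "v \<in> carrier_vec n" for v
    unfolding foldl_Cons IH[THEN conjunct2, rule_format, OF v]
      annihilates_append_rows[OF Cons.prems(1) cols(1) v] list.set by blast
  with IH show ?case by (simp only: foldl_Cons) blast
qed

text \<open>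
  The block row of \<open>H\<^sub>l\<^sub>,\<^sub>k\<close> that belongs to time \<open>j\<close>.  For \<open>j = k\<close> it is \<open>H\<^sub>k\<close>, so the top block needs
  no special treatment.
\<close>

definition stage_matrix :: "nat \<Rightarrow> (nat \<Rightarrow> real Matrix.mat) \<Rightarrow> (nat \<Rightarrow> real Matrix.mat) \<Rightarrow>
    (nat \<Rightarrow> real Matrix.mat) \<Rightarrow> nat \<Rightarrow> nat \<Rightarrow> real Matrix.mat" where
  "stage_matrix n F G H k j = (1\<^sub>m (2 ^ (j - k)) \<otimes>\<^sub>K H j) * phi n F G j k"

locale observed_system =
  fixes n m :: nat and F G H :: "nat \<Rightarrow> real Matrix.mat"
  assumes F: "F k \<in> carrier_mat n n" and G: "G k \<in> carrier_mat n n" and H: "H k \<in> carrier_mat m n"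
begin

lemma phi_carrier: "phi n F G j k \<in> carrier_mat (2 ^ (j - k) * n) n"
proof (induction "j - k" arbitrary: k)
  case 0
  thus ?case by (simp add: phi.simps)
next
  case (Suc d)
  from Suc have IH: "phi n F G j (Suc k) \<in> carrier_mat (2 ^ d * n) n" 
    by (metis Suc_diff_Suc diff_Suc_1' zero_less_Suc zero_less_diff diff_Suc_Suc)
  hence "(phi n F G j (Suc k) * F k) @\<^sub>r (phi n F G j (Suc k) * G k)
      \<in> carrier_mat (2 ^ d * n + 2 ^ d * n) n"
    using F G by (intro carrier_append_rows mult_carrier_mat)
  moreover have "2 ^ d * n + 2 ^ d * n = 2 ^ (j - k) * n" by (simp flip: Suc.hyps(2))
  moreover have "\<not> j \<le> k" using Suc.hyps(2) by simp
  ultimately show ?case by (subst phi.simps) simp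
qed

lemma kron_carrier: "1\<^sub>m r \<otimes>\<^sub>K H j \<in> carrier_mat (r * m) (r * n)"
  using carrier_matD[OF H[of j]] by (intro carrier_matI) (simp_all add: kronecker_def)

lemma stage_matrix_carrier: "stage_matrix n F G H k j \<in> carrier_mat (2 ^ (j - k) * m) n"
  unfolding stage_matrix_def using kron_carrier phi_carrier by (rule mult_carrier_mat)

lemma stage_matrix_self: "stage_matrix n F G H k k = H k"
  unfolding stage_matrix_def phi.simps[of n F G k k]
  using kronecker_one_one[of "H k"] H[of k] by simp

text \<open>
  The recursion \<open>\<phi>\<^sub>j\<^sub>,\<^sub>k = [\<phi>\<^sub>j\<^sub>,\<^sub>k\<^sub>+\<^sub>1 F\<^sub>k; \<phi>\<^sub>j\<^sub>,\<^sub>k\<^sub>+\<^sub>1 G\<^sub>k]\<close>, read on kernels.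
\<close>

lemma stage_matrix_step:
  assumes k: "k < j" and v: "v \<in> carrier_vec n"
  shows "annihilates (stage_matrix n F G H k j) v \<longleftrightarrow>
    annihilates (stage_matrix n F G H (Suc k) j) (F k *\<^sub>v v) \<and>
    annihilates (stage_matrix n F G H (Suc k) j) (G k *\<^sub>v v)"
proof -
  define r :: nat where "r = 2 ^ (j - Suc k)"
  have r2: "2 ^ (j - k) = 2 * r" using k by (simp add: r_def Suc_diff_Suc flip: power_Suc)
  let ?\<Phi> = "phi n F G j (Suc k)"
  have \<Phi>: "?\<Phi> \<in> carrier_mat (r * n) n" using phi_carrier unfolding r_def .
  note Fv = mult_mat_vec_carrier[OF F v, of k] and Gv = mult_mat_vec_carrier[OF G v, of k]
  note u = mult_mat_vec_carrier[OF \<Phi> Fv] mult_mat_vec_carrier[OF \<Phi> Gv]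
  have "phi n F G j k *\<^sub>v v = (?\<Phi> *\<^sub>v (F k *\<^sub>v v)) @\<^sub>v (?\<Phi> *\<^sub>v (G k *\<^sub>v v))"
    using k mat_mult_append[OF mult_carrier_mat[OF \<Phi> F] mult_carrier_mat[OF \<Phi> G] v]
      assoc_mult_mat_vec[OF \<Phi> F v] assoc_mult_mat_vec[OF \<Phi> G v]
    by (simp only: phi.simps[of n F G j k] not_le[symmetric] if_False)
  moreover have "stage_matrix n F G H k j *\<^sub>v v
      = (1\<^sub>m (2 * r) \<otimes>\<^sub>K H j) *\<^sub>v (phi n F G j k *\<^sub>v v)"
    using assoc_mult_mat_vec[OF kron_carrier phi_carrier v] unfolding stage_matrix_def r2[symmetric] .
  ultimately show ?thesis
    using kronecker_one_append_eq_0_iff[OF H u]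
      assoc_mult_mat_vec[OF kron_carrier \<Phi> Fv] assoc_mult_mat_vec[OF kron_carrier \<Phi> Gv]
    unfolding carrier_matD(1)[OF stage_matrix_carrier] r2 r_def[symmetric]
    unfolding stage_matrix_def r_def[symmetric] by (simp only:)
qed

lemma obs_matrix_rows:
  assumes "k \<le> l"
  shows "dim_col (obs_matrix n F G H l k) = n \<and> (\<forall>v \<in> carrier_vec n.
    annihilates (obs_matrix n F G H l k) v \<longleftrightarrow>
      (\<forall>j \<in> {k..l}. annihilates (stage_matrix n F G H k j) v))"
proof -
  let ?Bs = "map (stage_matrix n F G H k) [Suc k..<Suc l]"
  have "\<forall>C \<in> set ?Bs. dim_col C = n" using carrier_matD(2)[OF stage_matrix_carrier] by simp
  from annihilates_foldl_append_rows[OF carrier_matD(2)[OF H] this, of k]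
  have *: "dim_col (obs_matrix n F G H l k) = n \<and> (\<forall>v \<in> carrier_vec n.
    annihilates (obs_matrix n F G H l k) v \<longleftrightarrow>
      annihilates (H k) v \<and> (\<forall>C \<in> set ?Bs. annihilates C v))"
    unfolding obs_matrix_def stage_matrix_def[abs_def] .
  have "{k..l} = insert k {Suc k..l}" using assms by auto
  moreover have "set ?Bs = stage_matrix n F G H k ` {Suc k..l}"
    by (simp only: set_map set_upt atLeastLessThanSuc_atLeastAtMost)
  ultimately show ?thesis
    using * stage_matrix_self[of k] by simp
qed

lemma obs_matrix_0:
  "v \<in> carrier_vec n \<Longrightarrow> annihilates (obs_matrix n F G H k k) v \<longleftrightarrow> annihilates (H k) v"
  using obs_matrix_rows[of k k] by (simp add: stage_matrix_self)

text \<open>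
  Every stage after \<open>k\<close> sees \<open>v\<close> only through \<open>F\<^sub>k v\<close> and \<open>G\<^sub>k v\<close>, by \<open>stage_matrix_step\<close>.  From here on
  this backward recursion replaces \<open>\<phi>\<close> and the Kronecker products: the unobservable states and the
  null vectors of the Lyapunov solutions follow the same one.
\<close>

lemma obs_matrix_Suc:
  assumes v: "v \<in> carrier_vec n" and kl: "k < l"
  shows "annihilates (obs_matrix n F G H l k) v \<longleftrightarrow>
    annihilates (H k) v \<and>
    annihilates (obs_matrix n F G H l (Suc k)) (F k *\<^sub>v v) \<and>
    annihilates (obs_matrix n F G H l (Suc k)) (G k *\<^sub>v v)"
proof -
  have obs: "annihilates (obs_matrix n F G H l k) v \<longleftrightarrow>
      (\<forall>j \<in> {k..l}. annihilates (stage_matrix n F G H k j) v)"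
    if "k \<le> l" "v \<in> carrier_vec n" for k v using obs_matrix_rows that by blast
  have "{k..l} = insert k {Suc k..l}" using kl by auto
  hence "annihilates (obs_matrix n F G H l k) v \<longleftrightarrow>
      annihilates (H k) v \<and> (\<forall>j \<in> {Suc k..l}. annihilates (stage_matrix n F G H k j) v)"
    unfolding obs[OF less_imp_le[OF kl] v] using stage_matrix_self[of k] by simp
  also have "(\<forall>j \<in> {Suc k..l}. annihilates (stage_matrix n F G H k j) v) \<longleftrightarrow>
      (\<forall>j \<in> {Suc k..l}. annihilates (stage_matrix n F G H (Suc k) j) (F k *\<^sub>v v) \<and>
        annihilates (stage_matrix n F G H (Suc k) j) (G k *\<^sub>v v))"
    by (intro ball_cong refl stage_matrix_step v) simp
  finally show ?thesis
    unfolding obs[OF Suc_leI[OF kl] mult_mat_vec_carrier[OF F v]]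
      obs[OF Suc_leI[OF kl] mult_mat_vec_carrier[OF G v]] by blast
qed

end

section \<open>White noise and its past\<close>

locale white_noise_space = prob_space M for M :: "'a measure" +
  fixes w :: "nat \<Rightarrow> 'a \<Rightarrow> real"
  assumes noise: "white_noise M w"
begin

lemma w_indep: "indep_vars (\<lambda>_. borel) w UNIV"
  using noise unfolding white_noise_def by blast

lemma w_measurable [measurable]: "w k \<in> borel_measurable M"
  using w_indep unfolding indep_vars_def2 by auto

lemma w_mean: "expectation (w k) = 0"
  using noise unfolding white_noise_def by blast

lemma w_variance: "expectation (\<lambda>\<omega>. (w k \<omega>)\<^sup>2) = 1"
  using noise unfolding white_noise_def power2_eq_square by auto

lemma w_square_integrable: "integrable M (\<lambda>\<omega>. (w k \<omega>)\<^sup>2)"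
  using w_variance[of k] not_integrable_integral_eq by fastforce

lemma w_integrable: "integrable M (w k)"
  using square_integrable_imp_integrable[OF w_measurable w_square_integrable] .

lemma past_eq:
  "past M w k = sigma (space M) (\<Union>j<k. {w j -` B \<inter> space M | B. B \<in> sets borel})"
  unfolding past_def by (rule arg_cong[where f = "sigma (space M)"]) blast

lemma space_past [simp]: "space (past M w k) = space M"
  by (simp add: past_def space_measure_of_conv)

lemma sets_past:
  "sets (past M w k) = sigma_sets (space M) (\<Union>j<k. {w j -` B \<inter> space M | B. B \<in> sets borel})"
  unfolding past_eq by (rule sets_measure_of) auto

text \<open>
  \<open>w\<^sub>k\<close> is independent of its whole past, and not only of each earlier \<open>w\<^sub>j\<close>: the index set is split
  into the two disjoint groups \<open>{0, \<dots>, k - 1}\<close> and \<open>{k}\<close>.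
\<close>

lemma past_indep_set:
  "indep_set (sets (past M w k)) (sigma_sets (space M) {w k -` B \<inter> space M | B. B \<in> sets borel})"
proof -
  let ?E = "\<lambda>i. {w i -` B \<inter> space M | B. B \<in> sets borel}"
  let ?I = "case_bool {..<k} {k}"
  have "indep_sets (\<lambda>j. sigma_sets (space M) (\<Union>i\<in>?I j. ?E i)) UNIV"
  proof (rule indep_sets_collect_sigma)
    show "indep_sets ?E (\<Union>j\<in>UNIV. ?I j)"
      using w_indep unfolding indep_vars_def2 by (auto intro: indep_sets_mono_index)
    show "Int_stable (?E i)" for i
      unfolding Int_stable_def
    proof safe
      fix A B :: "real set" assume "A \<in> sets borel" "B \<in> sets borel"
      thus "\<exists>C. (w i -` A \<inter> space M) \<inter> (w i -` B \<inter> space M) = w i -` C \<inter> space M \<and> C \<in> sets borel"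
        by (intro exI[of _ "A \<inter> B"]) auto
    qed
    show "disjoint_family ?I"
      by (auto simp: disjoint_family_on_def split: bool.split)
  qed
  thus ?thesis
    unfolding indep_set_def sets_past
    by (rule indep_sets_mono_sets) (auto split: bool.split)
qed

lemma measurable_past_imp_measurable:
  assumes "f \<in> borel_measurable (past M w k)"
  shows "f \<in> borel_measurable M"
  using assms indep_setD_ev1[OF past_indep_set[of k]] measurable_mono[of borel borel "past M w k" M]
  by auto

lemma past_indep_var:
  assumes f: "f \<in> borel_measurable (past M w k)"
  shows "indep_var borel f borel (w k)"
  unfolding indep_var_eq
proof (intro conjI measurable_past_imp_measurable[OF f] w_measurable)
  have "sigma_sets (space M) {f -` A \<inter> space M | A. A \<in> sets borel} \<subseteq> sets (past M w k)"
    using sets.sigma_sets_subset[of "{f -` A \<inter> space M | A. A \<in> sets borel}" "past M w k"]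
      measurable_sets[OF f] unfolding space_past by blast
  thus "indep_set (sigma_sets (space M) {f -` A \<inter> space M | A. A \<in> sets borel})
     (sigma_sets (space M) {w k -` A \<inter> space M | A. A \<in> sets borel})"
    using past_indep_set[of k] unfolding indep_sets2_eq by blast
qed

lemma past_mono:
  assumes "f \<in> borel_measurable (past M w k)"
  shows "f \<in> borel_measurable (past M w (Suc k))"
proof -
  have "sets (past M w k) \<subseteq> sets (past M w (Suc k))"
    unfolding sets_past by (rule sigma_sets_mono', rule UN_mono) auto
  thus ?thesis using assms measurable_mono[of borel borel "past M w k" "past M w (Suc k)"] by auto
qed

lemma w_past: "w k \<in> borel_measurable (past M w (Suc k))"
proof (rule measurableI)
  fix B :: "real set" assume "B \<in> sets borel"
  thus "w k -` B \<inter> space (past M w (Suc k)) \<in> sets (past M w (Suc k))"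
    unfolding sets_past space_past by (intro sigma_sets.Basic) blast
qed auto

text \<open>
  In \<open>(a + w\<^sub>k b)\<^sup>2 = a\<^sup>2 + 2 a b w\<^sub>k + b\<^sup>2 w\<^sub>k\<^sup>2\<close>, the noise \<open>w\<^sub>k\<close> is independent of \<open>a b\<close> and \<open>b\<close>; it has
  mean zero, which removes the cross term, and variance one.
\<close>

lemma second_moment_step:
  assumes a: "a \<in> borel_measurable (past M w k)" and b: "b \<in> borel_measurable (past M w k)"
    and a2: "integrable M (\<lambda>\<omega>. (a \<omega>)\<^sup>2)" and b2: "integrable M (\<lambda>\<omega>. (b \<omega>)\<^sup>2)"
  shows "integrable M (\<lambda>\<omega>. (a \<omega> + w k \<omega> * b \<omega>)\<^sup>2)"
    and "expectation (\<lambda>\<omega>. (a \<omega> + w k \<omega> * b \<omega>)\<^sup>2)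
      = expectation (\<lambda>\<omega>. (a \<omega>)\<^sup>2) + expectation (\<lambda>\<omega>. (b \<omega>)\<^sup>2)"
proof -
  note [measurable] = measurable_past_imp_measurable[OF a] measurable_past_imp_measurable[OF b]
  have ab: "integrable M (\<lambda>\<omega>. a \<omega> * b \<omega>)"
  proof (rule Bochner_Integration.integrable_bound)
    show "integrable M (\<lambda>\<omega>. (a \<omega>)\<^sup>2 + (b \<omega>)\<^sup>2)" using a2 b2 by simp
    have "\<bar>x * y\<bar> \<le> x\<^sup>2 + y\<^sup>2" for x y :: real
      using sum_squares_bound[of "\<bar>x\<bar>" "\<bar>y\<bar>"] mult_nonneg_nonneg[of "\<bar>x\<bar>" "\<bar>y\<bar>"]
      unfolding abs_mult power2_abs by linarith
    thus "AE \<omega> in M. norm (a \<omega> * b \<omega>) \<le> norm ((a \<omega>)\<^sup>2 + (b \<omega>)\<^sup>2)" by auto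
  qed simp
  have "indep_var borel (\<lambda>\<omega>. a \<omega> * b \<omega>) borel (w k)"
    using a b by (intro past_indep_var) simp
  note cross = indep_var_integrable[OF this ab w_integrable]
    indep_var_lebesgue_integral[OF this ab w_integrable]
  have "indep_var borel ((\<lambda>x. x\<^sup>2) \<circ> b) borel ((\<lambda>x. x\<^sup>2) \<circ> w k)"
    by (rule indep_var_compose[OF past_indep_var[OF b]]) simp_all
  hence "indep_var borel (\<lambda>\<omega>. (b \<omega>)\<^sup>2) borel (\<lambda>\<omega>. (w k \<omega>)\<^sup>2)" by (simp add: comp_def)
  note square = indep_var_integrable[OF this b2 w_square_integrable]
    indep_var_lebesgue_integral[OF this b2 w_square_integrable]
  have eq: "(a \<omega> + w k \<omega> * b \<omega>)\<^sup>2
      = (a \<omega>)\<^sup>2 + 2 * (a \<omega> * b \<omega> * w k \<omega>) + (b \<omega>)\<^sup>2 * (w k \<omega>)\<^sup>2" for \<omega>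
    by (simp add: power2_eq_square algebra_simps)
  show "integrable M (\<lambda>\<omega>. (a \<omega> + w k \<omega> * b \<omega>)\<^sup>2)"
    unfolding eq using a2 cross(1) square(1) by simp
  show "expectation (\<lambda>\<omega>. (a \<omega> + w k \<omega> * b \<omega>)\<^sup>2)
      = expectation (\<lambda>\<omega>. (a \<omega>)\<^sup>2) + expectation (\<lambda>\<omega>. (b \<omega>)\<^sup>2)"
    unfolding eq using a2 cross square by (simp add: w_mean w_variance)
qed

text \<open>
  The probabilistic heart of the argument: a null combination of two past variables with a fresh
  noise term as coefficient has both parts null, because the two parts are orthogonal in \<open>L\<^sup>2\<close>.
\<close>

lemma noise_separates:
  assumes a: "a \<in> borel_measurable (past M w k)" and b: "b \<in> borel_measurable (past M w k)"
    and a2: "integrable M (\<lambda>\<omega>. (a \<omega>)\<^sup>2)" and b2: "integrable M (\<lambda>\<omega>. (b \<omega>)\<^sup>2)"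
    and z: "AE \<omega> in M. a \<omega> + w k \<omega> * b \<omega> = 0"
  shows "AE \<omega> in M. a \<omega> = 0 \<and> b \<omega> = 0"
proof -
  have "expectation (\<lambda>\<omega>. (a \<omega> + w k \<omega> * b \<omega>)\<^sup>2) = 0"
    using z by (intro integral_eq_zero_AE) auto
  with second_moment_step(2)[OF a b a2 b2]
  have "expectation (\<lambda>\<omega>. (a \<omega>)\<^sup>2) + expectation (\<lambda>\<omega>. (b \<omega>)\<^sup>2) = 0" by simp
  moreover have "0 \<le> expectation (\<lambda>\<omega>. (a \<omega>)\<^sup>2)" "0 \<le> expectation (\<lambda>\<omega>. (b \<omega>)\<^sup>2)" by simp_all
  ultimately have "expectation (\<lambda>\<omega>. (a \<omega>)\<^sup>2) = 0" "expectation (\<lambda>\<omega>. (b \<omega>)\<^sup>2) = 0" by linarith+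
  thus ?thesis
    using integral_nonneg_eq_0_iff_AE[OF a2] integral_nonneg_eq_0_iff_AE[OF b2] by simp
qed

text \<open>
  Cauchy--Schwarz bounds \<open>(c \<bullet> x)\<^sup>2\<close> by \<open>(c \<bullet> c) (x \<bullet> x)\<close>, so every linear functional of an admissible
  state is a scalar to which the two preceding lemmas apply.
\<close>

lemma l2_past_functional:
  assumes x: "x \<in> l2_past M w n k" and c: "c \<in> carrier_vec n"
  shows "(\<lambda>\<omega>. scalar_prod c (x \<omega>)) \<in> borel_measurable (past M w k)"
    and "integrable M (\<lambda>\<omega>. (scalar_prod c (x \<omega>))\<^sup>2)"
proof -
  have dim: "dim_vec (x \<omega>) = n" if "\<omega> \<in> space M" for \<omega>
    using x that unfolding l2_past_def by auto
  have meas: "(\<lambda>\<omega>. vec_index (x \<omega>) i) \<in> borel_measurable (past M w k)" if "i < n" for i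
    using x that unfolding l2_past_def by auto
  have "(\<lambda>\<omega>. \<Sum>i<n. vec_index c i * vec_index (x \<omega>) i) \<in> borel_measurable (past M w k)"
    using meas by (intro borel_measurable_sum borel_measurable_times) auto
  moreover have "scalar_prod c (x \<omega>) = (\<Sum>i<n. vec_index c i * vec_index (x \<omega>) i)"
    if "\<omega> \<in> space M" for \<omega>
    using dim[OF that] by (simp add: scalar_prod_def lessThan_atLeast0)
  ultimately show m: "(\<lambda>\<omega>. scalar_prod c (x \<omega>)) \<in> borel_measurable (past M w k)"
    by (subst measurable_cong) auto
  have "integrable M (\<lambda>\<omega>. scalar_prod c c * scalar_prod (x \<omega>) (x \<omega>))"
    using x unfolding l2_past_def by auto
  thus "integrable M (\<lambda>\<omega>. (scalar_prod c (x \<omega>))\<^sup>2)"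
  proof (rule Bochner_Integration.integrable_bound)
    show "(\<lambda>\<omega>. (scalar_prod c (x \<omega>))\<^sup>2) \<in> borel_measurable M"
      using measurable_past_imp_measurable[OF m] by simp
    have "(scalar_prod c (x \<omega>))\<^sup>2 \<le> scalar_prod c c * scalar_prod (x \<omega>) (x \<omega>)"
      if "\<omega> \<in> space M" for \<omega>
      using dim[OF that] carrier_vecD[OF c]
        Cauchy_Schwarz_ineq_sum[of "vec_index c" "vec_index (x \<omega>)" "{0..<n}"]
      by (simp add: scalar_prod_def power2_eq_square)
    thus "AE \<omega> in M. norm ((scalar_prod c (x \<omega>))\<^sup>2)
        \<le> norm (scalar_prod c c * scalar_prod (x \<omega>) (x \<omega>))"
      by (intro AE_I2) (metis abs_ge_self abs_of_nonneg order_trans real_norm_def zero_le_power2)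
  qed
qed

end

section \<open>Unobservable states\<close>

lemma trajectory_start: "trajectory F G w k x k = x"
  by (cases k) auto

lemma trajectory_Suc: "k0 \<le> k \<Longrightarrow> trajectory F G w k0 x (Suc k) =
    (\<lambda>\<omega>. F k *\<^sub>v trajectory F G w k0 x k \<omega> + w k \<omega> \<cdot>\<^sub>v (G k *\<^sub>v trajectory F G w k0 x k \<omega>))"
  by simp

text \<open>
  Unobservability can be analysed by induction on the horizon because the system can be restarted
  after each step; the induction on \<open>j\<close> works since both sides follow the same dynamics from \<open>k + 1\<close> on.
\<close>

lemma trajectory_shift:
  "trajectory F G w k x (Suc k + j) =
    trajectory F G w (Suc k) (\<lambda>\<omega>. F k *\<^sub>v x \<omega> + w k \<omega> \<cdot>\<^sub>v (G k *\<^sub>v x \<omega>)) (Suc k + j)"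
proof (induction j)
  case 0
  show ?case by (simp add: trajectory_Suc trajectory_start del: trajectory.simps)
next
  case (Suc j)
  have "k \<le> Suc k + j" "Suc k \<le> Suc k + j" by simp_all
  with Suc show ?case
    by (simp only: add_Suc_right trajectory_Suc)
qed

lemma annihilates_zero: "dim_col A = n \<Longrightarrow> annihilates A (0\<^sub>v n)"
  by (rule eq_vecI) (simp_all add: scalar_prod_def)

lemma scalar_prod_self: "scalar_prod v v = (\<Sum>i<dim_vec v. (vec_index v i)\<^sup>2)" for v :: "real Matrix.vec"
  by (simp add: scalar_prod_def power2_eq_square atLeast0LessThan)

locale stochastic_system = white_noise_space M w + observed_system n m F G H
  for M :: "'a measure" and w :: "nat \<Rightarrow> 'a \<Rightarrow> real"
    and n m :: nat and F G H :: "nat \<Rightarrow> real Matrix.mat"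
begin

abbreviation next_state :: "nat \<Rightarrow> ('a \<Rightarrow> real Matrix.vec) \<Rightarrow> 'a \<Rightarrow> real Matrix.vec" where
  "next_state k x \<equiv> \<lambda>\<omega>. F k *\<^sub>v x \<omega> + w k \<omega> \<cdot>\<^sub>v (G k *\<^sub>v x \<omega>)"

lemma l2_past_carrier: "x \<in> l2_past M w n k \<Longrightarrow> \<omega> \<in> space M \<Longrightarrow> x \<omega> \<in> carrier_vec n"
  unfolding l2_past_def by blast

text \<open>
  Needed to restart the system one step later: the new state is again an admissible initial state.
  Square integrability survives because \<open>w\<^sub>k\<close> is independent of \<open>x\<close>.
\<close>

lemma next_state_l2_past:
  assumes x: "x \<in> l2_past M w n k"
  shows "next_state k x \<in> l2_past M w n (Suc k)"
proof -
  let ?a = "\<lambda>i \<omega>. scalar_prod (Matrix.row (F k) i) (x \<omega>)"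
  let ?b = "\<lambda>i \<omega>. scalar_prod (Matrix.row (G k) i) (x \<omega>)"
  have rows: "Matrix.row (F k) i \<in> carrier_vec n" "Matrix.row (G k) i \<in> carrier_vec n" for i
    using carrier_matD[OF F[of k]] carrier_matD[OF G[of k]] by (auto intro: carrier_vecI)
  have carrier: "next_state k x \<omega> \<in> carrier_vec n" if "\<omega> \<in> space M" for \<omega>
    by (intro add_carrier_vec smult_carrier_vec[THEN iffD2]
      mult_mat_vec_carrier[OF F] mult_mat_vec_carrier[OF G] l2_past_carrier[OF x that])
  have entry: "vec_index (next_state k x \<omega>) i = ?a i \<omega> + w k \<omega> * ?b i \<omega>" if "i < n" for i \<omega>
    using that carrier_matD[OF F[of k]] carrier_matD[OF G[of k]] by simp
  have meas: "(\<lambda>\<omega>. vec_index (next_state k x \<omega>) i) \<in> borel_measurable (past M w (Suc k))"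
    if "i < n" for i
    unfolding entry[OF that]
    by (intro borel_measurable_add borel_measurable_times w_past past_mono
      l2_past_functional(1)[OF x] rows)
  have "integrable M (\<lambda>\<omega>. \<Sum>i<n. (?a i \<omega> + w k \<omega> * ?b i \<omega>)\<^sup>2)"
    by (intro Bochner_Integration.integrable_sum second_moment_step(1)
      l2_past_functional[OF x] rows)
  moreover have "scalar_prod (next_state k x \<omega>) (next_state k x \<omega>)
      = (\<Sum>i<n. (?a i \<omega> + w k \<omega> * ?b i \<omega>)\<^sup>2)" if "\<omega> \<in> space M" for \<omega>
    unfolding scalar_prod_self carrier_vecD[OF carrier[OF that]]
    by (intro sum.cong) (simp_all only: entry lessThan_iff)
  ultimately have "integrable M (\<lambda>\<omega>. scalar_prod (next_state k x \<omega>) (next_state k x \<omega>))"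
    using Bochner_Integration.integrable_cong[OF refl] by (metis (no_types, lifting))
  with carrier meas show ?thesis unfolding l2_past_def by blast
qed

text \<open>
  Each row of \<open>C\<close> gives one equation \<open>a + w\<^sub>k b = 0\<close>, where \<open>a\<close> and \<open>b\<close> are the corresponding rows of
  \<open>C F\<^sub>k\<close> and \<open>C G\<^sub>k\<close> applied to \<open>x\<close>.  These are finitely many null sets, so the rows can be handled
  one by one.
\<close>

lemma AE_annihilates_next_state_iff:
  assumes C: "C \<in> carrier_mat p n" and x: "x \<in> l2_past M w n k"
  shows "(AE \<omega> in M. annihilates C (next_state k x \<omega>)) \<longleftrightarrow>
    (AE \<omega> in M. annihilates C (F k *\<^sub>v x \<omega>) \<and> annihilates C (G k *\<^sub>v x \<omega>))"
proof -
  let ?a = "\<lambda>i \<omega>. scalar_prod (Matrix.row (C * F k) i) (x \<omega>)"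
  let ?b = "\<lambda>i \<omega>. scalar_prod (Matrix.row (C * G k) i) (x \<omega>)"
  have CF: "C * F k \<in> carrier_mat p n" and CG: "C * G k \<in> carrier_mat p n"
    using mult_carrier_mat[OF C F] mult_carrier_mat[OF C G] .
  have rows: "Matrix.row (C * F k) i \<in> carrier_vec n" "Matrix.row (C * G k) i \<in> carrier_vec n" for i
    using carrier_matD[OF CF] carrier_matD[OF CG] by (auto intro: carrier_vecI)
  have kernel: "annihilates C y \<longleftrightarrow> (\<forall>i<p. vec_index (C *\<^sub>v y) i = 0)" for y
    using carrier_matD(1)[OF C] by (auto simp: Matrix.vec_eq_iff)
  have Fx: "vec_index (C *\<^sub>v (F k *\<^sub>v x \<omega>)) i = ?a i \<omega>"
    and Gx: "vec_index (C *\<^sub>v (G k *\<^sub>v x \<omega>)) i = ?b i \<omega>"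
    and step: "vec_index (C *\<^sub>v next_state k x \<omega>) i = ?a i \<omega> + w k \<omega> * ?b i \<omega>"
    if i: "i < p" and "\<omega> \<in> space M" for i \<omega>
  proof -
    note xc = l2_past_carrier[OF x \<open>\<omega> \<in> space M\<close>]
    note Fc = mult_mat_vec_carrier[OF F xc, of k] and Gc = mult_mat_vec_carrier[OF G xc, of k]
    show 1: "vec_index (C *\<^sub>v (F k *\<^sub>v x \<omega>)) i = ?a i \<omega>"
      unfolding assoc_mult_mat_vec[OF C F xc, symmetric]
      using i carrier_matD(1)[OF CF] by (intro index_mult_mat_vec) simp
    show 2: "vec_index (C *\<^sub>v (G k *\<^sub>v x \<omega>)) i = ?b i \<omega>"
      unfolding assoc_mult_mat_vec[OF C G xc, symmetric]
      using i carrier_matD(1)[OF CG] by (intro index_mult_mat_vec) simp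
    have "C *\<^sub>v next_state k x \<omega> = C *\<^sub>v (F k *\<^sub>v x \<omega>) + w k \<omega> \<cdot>\<^sub>v (C *\<^sub>v (G k *\<^sub>v x \<omega>))"
      using mult_add_distrib_mat_vec[OF C Fc smult_carrier_vec[THEN iffD2, OF Gc]]
        mult_mat_vec[OF C Gc] by (simp only:)
    moreover have "dim_vec (C *\<^sub>v (G k *\<^sub>v x \<omega>)) = p" using carrier_matD(1)[OF C] by simp
    ultimately show "vec_index (C *\<^sub>v next_state k x \<omega>) i = ?a i \<omega> + w k \<omega> * ?b i \<omega>"
      using i by (simp only: index_add_vec index_smult_vec 1 2)
  qed
  have "(AE \<omega> in M. annihilates C (next_state k x \<omega>)) \<longleftrightarrow>
      (AE \<omega> in M. \<forall>i<p. ?a i \<omega> + w k \<omega> * ?b i \<omega> = 0)"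
    unfolding kernel using step by (intro AE_cong) simp
  also have "\<dots> \<longleftrightarrow> (\<forall>i<p. AE \<omega> in M. ?a i \<omega> + w k \<omega> * ?b i \<omega> = 0)"
    using AE_finite_all[of "{..<p}" "\<lambda>\<omega> i. ?a i \<omega> + w k \<omega> * ?b i \<omega> = 0" "ae_filter M"]
    by (simp add: Ball_def)
  also have "\<dots> \<longleftrightarrow> (\<forall>i<p. AE \<omega> in M. ?a i \<omega> = 0 \<and> ?b i \<omega> = 0)"
  proof (intro all_cong iffI)
    fix i assume "AE \<omega> in M. ?a i \<omega> + w k \<omega> * ?b i \<omega> = 0"
    thus "AE \<omega> in M. ?a i \<omega> = 0 \<and> ?b i \<omega> = 0"
      by (rule noise_separates[OF l2_past_functional(1)[OF x rows(1)]
        l2_past_functional(1)[OF x rows(2)] l2_past_functional(2)[OF x rows(1)]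
        l2_past_functional(2)[OF x rows(2)]])
  next
    fix i assume "AE \<omega> in M. ?a i \<omega> = 0 \<and> ?b i \<omega> = 0"
    thus "AE \<omega> in M. ?a i \<omega> + w k \<omega> * ?b i \<omega> = 0" by eventually_elim simp
  qed
  also have "\<dots> \<longleftrightarrow> (AE \<omega> in M. \<forall>i<p. ?a i \<omega> = 0 \<and> ?b i \<omega> = 0)"
    using AE_finite_all[of "{..<p}" "\<lambda>\<omega> i. ?a i \<omega> = 0 \<and> ?b i \<omega> = 0" "ae_filter M"]
    by (simp add: Ball_def)
  also have "\<dots> \<longleftrightarrow> (AE \<omega> in M. annihilates C (F k *\<^sub>v x \<omega>) \<and> annihilates C (G k *\<^sub>v x \<omega>))"
    unfolding kernel using Fx Gx by (intro AE_cong) auto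
  finally show ?thesis .
qed

lemma unobservable_Suc:
  assumes x: "x \<in> l2_past M w n k"
  shows "unobservable M w n m F G H k (Suc s) x \<longleftrightarrow>
    (AE \<omega> in M. H k *\<^sub>v x \<omega> = 0\<^sub>v m) \<and> unobservable M w n m F G H (Suc k) s (next_state k x)"
proof -
  let ?Q = "\<lambda>j. AE \<omega> in M. H j *\<^sub>v trajectory F G w k x j \<omega> = 0\<^sub>v m"
  have times: "{k..k + Suc s} = insert k {Suc k..Suc k + s}" by auto
  have "(\<forall>j \<in> {Suc k..Suc k + s}. ?Q j) \<longleftrightarrow> (\<forall>j \<in> {Suc k..Suc k + s}.
      AE \<omega> in M. H j *\<^sub>v trajectory F G w (Suc k) (next_state k x) j \<omega> = 0\<^sub>v m)"
  proof (intro ball_cong refl)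
    fix j assume "j \<in> {Suc k..Suc k + s}"
    then obtain d where "j = Suc k + d" using le_Suc_ex by (metis atLeastAtMost_iff)
    thus "?Q j \<longleftrightarrow> (AE \<omega> in M. H j *\<^sub>v trajectory F G w (Suc k) (next_state k x) j \<omega> = 0\<^sub>v m)"
      by (simp only: trajectory_shift)
  qed
  thus ?thesis
    using x next_state_l2_past[OF x]
    unfolding unobservable_def times by (simp add: trajectory_start del: trajectory.simps)
qed

text \<open>
  The key characterization: a random state is unobservable exactly when almost all of its values lie
  in the deterministic kernel of \<open>H\<^sub>k\<^sub>+\<^sub>s\<^sub>,\<^sub>k\<close>.  Both sides satisfy the same recursion in \<open>s\<close>: passing to
  the next state on the left, and \<open>obs_matrix_Suc\<close> on the right, linked by
  \<open>AE_annihilates_next_state_iff\<close>.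
\<close>

theorem unobservable_iff:
  assumes "x \<in> l2_past M w n k"
  shows "unobservable M w n m F G H k s x \<longleftrightarrow>
    (AE \<omega> in M. annihilates (obs_matrix n F G H (k + s) k) (x \<omega>))"
  using assms
proof (induction s arbitrary: k x)
  case 0
  have "unobservable M w n m F G H k 0 x \<longleftrightarrow> (AE \<omega> in M. annihilates (H k) (x \<omega>))"
    using 0 carrier_matD(1)[OF H[of k]] by (simp add: unobservable_def trajectory_start)
  also have "\<dots> \<longleftrightarrow> (AE \<omega> in M. annihilates (obs_matrix n F G H k k) (x \<omega>))"
    using obs_matrix_0 l2_past_carrier[OF 0] by (intro AE_cong) blast
  finally show ?case by simp
next
  case (Suc s)
  let ?O = "obs_matrix n F G H (k + Suc s) (Suc k)"
  have O: "?O \<in> carrier_mat (dim_row ?O) n"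
    using obs_matrix_rows[of "Suc k" "k + Suc s"] by auto
  have "unobservable M w n m F G H k (Suc s) x \<longleftrightarrow>
      (AE \<omega> in M. annihilates (H k) (x \<omega>)) \<and> (AE \<omega> in M. annihilates ?O (next_state k x \<omega>))"
    using unobservable_Suc[OF Suc.prems] Suc.IH[OF next_state_l2_past[OF Suc.prems]]
      carrier_matD(1)[OF H[of k]] by simp
  also have "\<dots> \<longleftrightarrow> (AE \<omega> in M. annihilates (H k) (x \<omega>) \<and>
      annihilates ?O (F k *\<^sub>v x \<omega>) \<and> annihilates ?O (G k *\<^sub>v x \<omega>))"
    unfolding AE_annihilates_next_state_iff[OF O Suc.prems] by (simp only: AE_conj_iff)
  also have "\<dots> \<longleftrightarrow> (AE \<omega> in M. annihilates (obs_matrix n F G H (k + Suc s) k) (x \<omega>))"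
    using obs_matrix_Suc[of _ k "k + Suc s"] l2_past_carrier[OF Suc.prems]
    by (intro AE_cong) (simp only: less_add_Suc1)
  finally show ?case .
qed

lemma const_l2_past:
  assumes "v \<in> carrier_vec n"
  shows "(\<lambda>_. v) \<in> l2_past M w n k"
  using assms unfolding l2_past_def by simp

text \<open>
  A nonzero vector of the kernel, taken as a constant random state, would be a nonzero unobservable
  state; conversely a trivial kernel forces every unobservable state to vanish almost surely.
\<close>

theorem exactly_observable_iff:
  "exactly_observable_at M w n m F G H k s \<longleftrightarrow>
    (\<forall>v \<in> carrier_vec n. annihilates (obs_matrix n F G H (k + s) k) v \<longrightarrow> v = 0\<^sub>v n)"
    (is "_ \<longleftrightarrow> ?trivial")
proof
  let ?O = "obs_matrix n F G H (k + s) k"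
  have O: "?O \<in> carrier_mat (dim_row ?O) n" using obs_matrix_rows[of k "k + s"] by auto
  {
    assume obs: "exactly_observable_at M w n m F G H k s"
    show ?trivial
    proof (intro ballI impI)
      fix v :: "real Matrix.vec" assume v: "v \<in> carrier_vec n" and "annihilates ?O v"
      hence "unobservable M w n m F G H k s (\<lambda>_. v)"
        using unobservable_iff[OF const_l2_past] by simp
      moreover have "unobservable M w n m F G H k s (\<lambda>_. v) \<longleftrightarrow> (AE \<omega> in M. v = 0\<^sub>v n)"
        using bspec[OF obs[unfolded exactly_observable_at_def] const_l2_past[OF v]] .
      ultimately show "v = 0\<^sub>v n" by simp
    qed
  next
    assume triv: ?trivial
    have "annihilates ?O (0\<^sub>v n)" by (rule annihilates_zero) (rule carrier_matD(2)[OF O])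
    with triv have kernel: "annihilates ?O v \<longleftrightarrow> v = 0\<^sub>v n" if "v \<in> carrier_vec n" for v
      using that by blast
    show "exactly_observable_at M w n m F G H k s"
      unfolding exactly_observable_at_def
    proof (intro ballI)
      fix x assume x: "x \<in> l2_past M w n k"
      show "unobservable M w n m F G H k s x \<longleftrightarrow> (AE \<omega> in M. x \<omega> = 0\<^sub>v n)"
        unfolding unobservable_iff[OF x] by (intro AE_cong kernel l2_past_carrier[OF x])
    qed
  }
qed

end

section \<open>Gramians and the Lyapunov equation\<close>

lemma scalar_prod_self_nonneg: "0 \<le> scalar_prod v v" for v :: "real Matrix.vec"
  unfolding scalar_prod_self by (intro sum_nonneg) simp

lemma scalar_prod_self_eq_0_iff:
  "scalar_prod v v = 0 \<longleftrightarrow> v = 0\<^sub>v (dim_vec v)" for v :: "real Matrix.vec"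
  unfolding scalar_prod_self by (subst sum_nonneg_eq_0_iff) (auto simp: Matrix.vec_eq_iff)

lemma quadratic_form_congruence:
  fixes A Q :: "real Matrix.mat"
  assumes A: "A \<in> carrier_mat p n" and Q: "Q \<in> carrier_mat p p" and v: "v \<in> carrier_vec n"
  shows "scalar_prod v ((transpose_mat A * Q * A) *\<^sub>v v) = scalar_prod (A *\<^sub>v v) (Q *\<^sub>v (A *\<^sub>v v))"
proof -
  note At = transpose_carrier_mat[THEN iffD2, OF A]
  note Av = mult_mat_vec_carrier[OF A v]
  note QAv = mult_mat_vec_carrier[OF Q Av]
  have "(transpose_mat A * Q * A) *\<^sub>v v = transpose_mat A *\<^sub>v (Q *\<^sub>v (A *\<^sub>v v))"
    unfolding assoc_mult_mat_vec[OF mult_carrier_mat[OF At Q] A v]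
    by (rule assoc_mult_mat_vec[OF At Q Av])
  thus ?thesis
    using transpose_vec_mult_scalar[OF At QAv v] by (simp only: transpose_transpose)
qed

lemma quadratic_form_gram:
  fixes A :: "real Matrix.mat"
  assumes A: "A \<in> carrier_mat p n" and v: "v \<in> carrier_vec n"
  shows "scalar_prod v ((transpose_mat A * A) *\<^sub>v v) = scalar_prod (A *\<^sub>v v) (A *\<^sub>v v)"
proof -
  note At = transpose_carrier_mat[THEN iffD2, OF A]
  have "transpose_mat A * 1\<^sub>m p = transpose_mat A" using At by (rule right_mult_one_mat)
  thus ?thesis
    using quadratic_form_congruence[OF A one_carrier_mat v]
      one_mult_mat_vec[OF mult_mat_vec_carrier[OF A v]] by (simp only:)
qed

lemma pos_def_gram_iff:
  fixes A :: "real Matrix.mat"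
  assumes A: "A \<in> carrier_mat p n"
  shows "pos_def n (transpose_mat A * A) \<longleftrightarrow>
    (\<forall>v \<in> carrier_vec n. annihilates A v \<longrightarrow> v = 0\<^sub>v n)"
proof -
  note At = transpose_carrier_mat[THEN iffD2, OF A]
  have "transpose_mat (transpose_mat A * A) = transpose_mat A * A"
    using transpose_mult[OF At A] by simp
  moreover have "0 < scalar_prod v ((transpose_mat A * A) *\<^sub>v v) \<longleftrightarrow> \<not> annihilates A v"
    if "v \<in> carrier_vec n" for v
    unfolding quadratic_form_gram[OF A that]
    using scalar_prod_self_nonneg[of "A *\<^sub>v v"]
    unfolding less_le scalar_prod_self_eq_0_iff[of "A *\<^sub>v v", symmetric, unfolded dim_mult_mat_vec]
    by auto
  ultimately show ?thesis
    unfolding pos_def_def using mult_carrier_mat[OF At A] by blast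
qed

context observed_system
begin

lemma pos_def_gramian_iff:
  assumes "k \<le> l"
  shows "pos_def n (gramian n F G H l k) \<longleftrightarrow>
    (\<forall>v \<in> carrier_vec n. annihilates (obs_matrix n F G H l k) v \<longrightarrow> v = 0\<^sub>v n)"
proof -
  have "obs_matrix n F G H l k \<in> carrier_mat (dim_row (obs_matrix n F G H l k)) n"
    using obs_matrix_rows[OF assms] by auto
  thus ?thesis unfolding gramian_def by (rule pos_def_gram_iff)
qed

lemma lyapunov_quadratic_form:
  assumes P: "P k \<in> carrier_mat n n" "P (Suc k) \<in> carrier_mat n n"
    and lyapunov: "- P k + transpose_mat (F k) * P (Suc k) * F k
      + transpose_mat (G k) * P (Suc k) * G k + transpose_mat (H k) * H k = 0\<^sub>m n n"
    and v: "v \<in> carrier_vec n"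
  shows "scalar_prod v (P k *\<^sub>v v) = scalar_prod (F k *\<^sub>v v) (P (Suc k) *\<^sub>v (F k *\<^sub>v v))
    + scalar_prod (G k *\<^sub>v v) (P (Suc k) *\<^sub>v (G k *\<^sub>v v)) + scalar_prod (H k *\<^sub>v v) (H k *\<^sub>v v)"
proof -
  let ?X = "transpose_mat (F k) * P (Suc k) * F k"
  let ?Y = "transpose_mat (G k) * P (Suc k) * G k"
  let ?Z = "transpose_mat (H k) * H k"
  have X: "?X \<in> carrier_mat n n" and Y: "?Y \<in> carrier_mat n n" and Z: "?Z \<in> carrier_mat n n"
    using mult_carrier_mat[OF mult_carrier_mat[OF transpose_carrier_mat[THEN iffD2, OF F] P(2)] F]
      mult_carrier_mat[OF mult_carrier_mat[OF transpose_carrier_mat[THEN iffD2, OF G] P(2)] G]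
      mult_carrier_mat[OF transpose_carrier_mat[THEN iffD2, OF H] H] .
  note sum = add_carrier_mat[OF Z, of "?X + ?Y"]
  (* Compared entry by entry, since matrices with explicit dimensions do not form a group. *)
  have "P k = ?X + ?Y + ?Z"
  proof (rule eq_matI)
    fix i j assume "i < dim_row (?X + ?Y + ?Z)" "j < dim_col (?X + ?Y + ?Z)"
    hence ij: "i < n" "j < n" by (simp_all only: carrier_matD[OF sum])
    have "(- P k + ?X + ?Y + ?Z) $$ (i, j) = 0" unfolding lyapunov using ij by (rule index_zero_mat)
    thus "P k $$ (i, j) = (?X + ?Y + ?Z) $$ (i, j)"
      using ij carrier_matD[OF X] carrier_matD[OF Y] carrier_matD[OF Z] carrier_matD[OF P(1)]
      by (simp add: index_add_mat index_uminus_mat del: index_mult_mat)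
  qed (simp_all only: carrier_matD[OF sum] carrier_matD[OF P(1)])
  hence "P k *\<^sub>v v = ?X *\<^sub>v v + ?Y *\<^sub>v v + ?Z *\<^sub>v v"
    by (simp only: add_mult_distrib_mat_vec[OF add_carrier_mat[OF Y] Z v]
      add_mult_distrib_mat_vec[OF X Y v])
  hence "scalar_prod v (P k *\<^sub>v v)
      = scalar_prod v (?X *\<^sub>v v) + scalar_prod v (?Y *\<^sub>v v) + scalar_prod v (?Z *\<^sub>v v)"
    using mult_mat_vec_carrier[OF X v] mult_mat_vec_carrier[OF Y v] mult_mat_vec_carrier[OF Z v] v
    by (simp only: scalar_prod_add_distrib[of _ n] add_carrier_vec)
  thus ?thesis
    unfolding quadratic_form_congruence[OF F P(2) v] quadratic_form_congruence[OF G P(2) v]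
      quadratic_form_gram[OF H v] .
qed

text \<open>
  If \<open>v \<bullet> P\<^sub>k v = 0\<close>, the three nonnegative terms of \<open>lyapunov_quadratic_form\<close> all vanish: thus \<open>H\<^sub>k v = 0\<close>,
  while \<open>F\<^sub>k v\<close> and \<open>G\<^sub>k v\<close> are null vectors of \<open>P\<^sub>k\<^sub>+\<^sub>1\<close>.  Repeating this follows the recursion of the kernel
  of \<open>H\<^sub>k\<^sub>+\<^sub>s\<^sub>,\<^sub>k\<close> for as many steps as desired.
\<close>

lemma lyapunov_null_vector_unobserved:
  assumes P: "\<And>k. pos_semidef n (P k)"
    and lyapunov: "\<And>k. - P k + transpose_mat (F k) * P (Suc k) * F k
      + transpose_mat (G k) * P (Suc k) * G k + transpose_mat (H k) * H k = 0\<^sub>m n n"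
    and v: "v \<in> carrier_vec n" and null: "scalar_prod v (P k *\<^sub>v v) = 0"
  shows "annihilates (obs_matrix n F G H (k + s) k) v"
  using v null
proof -
  have terms: "annihilates (H k) v \<and> scalar_prod (F k *\<^sub>v v) (P (Suc k) *\<^sub>v (F k *\<^sub>v v)) = 0
      \<and> scalar_prod (G k *\<^sub>v v) (P (Suc k) *\<^sub>v (G k *\<^sub>v v)) = 0"
    if v: "v \<in> carrier_vec n" and null: "scalar_prod v (P k *\<^sub>v v) = 0" for k v
  proof -
    have carrier: "P j \<in> carrier_mat n n"
      and nonneg: "u \<in> carrier_vec n \<Longrightarrow> 0 \<le> scalar_prod u (P j *\<^sub>v u)" for j u
      using P unfolding pos_semidef_def by blast+
    have "scalar_prod (H k *\<^sub>v v) (H k *\<^sub>v v) = 0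
      \<and> scalar_prod (F k *\<^sub>v v) (P (Suc k) *\<^sub>v (F k *\<^sub>v v)) = 0
      \<and> scalar_prod (G k *\<^sub>v v) (P (Suc k) *\<^sub>v (G k *\<^sub>v v)) = 0"
      using lyapunov_quadratic_form[OF carrier carrier lyapunov v, of k]
        nonneg[OF mult_mat_vec_carrier[OF F v], of k "Suc k"]
        nonneg[OF mult_mat_vec_carrier[OF G v], of k "Suc k"]
        scalar_prod_self_nonneg[of "H k *\<^sub>v v"]
      unfolding null by linarith
    thus ?thesis unfolding scalar_prod_self_eq_0_iff dim_mult_mat_vec .
  qed
  show ?thesis
    using v null
  proof (induction s arbitrary: k v)
    case 0
    show ?case using terms[OF 0] obs_matrix_0[OF 0(1)] by (simp only: add_0_right)
  next
    case (Suc s)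
    have "annihilates (obs_matrix n F G H (Suc k + s) (Suc k)) (F k *\<^sub>v v)"
      "annihilates (obs_matrix n F G H (Suc k + s) (Suc k)) (G k *\<^sub>v v)"
      using terms[OF Suc.prems] mult_mat_vec_carrier[OF F Suc.prems(1), of k]
        mult_mat_vec_carrier[OF G Suc.prems(1), of k] by (blast intro: Suc.IH)+
    moreover have "Suc k + s = k + Suc s" "k < k + Suc s" by simp_all
    ultimately show ?case
      using terms[OF Suc.prems] obs_matrix_Suc[OF Suc.prems(1)] by (simp only:)
  qed
qed

end

section \<open>Observability criteria\<close>

theorem theorem4p2:
  fixes M :: "'a measure" and w :: "nat \<Rightarrow> 'a \<Rightarrow> real"
    and n m :: nat and F G H :: "nat \<Rightarrow> real Matrix.mat"
  assumes "prob_space M" and "white_noise M w"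
    and "0 < n" and "0 < m"
    and "\<And>k. F k \<in> carrier_mat n n" and "\<And>k. G k \<in> carrier_mat n n"
    and "\<And>k. H k \<in> carrier_mat m n"
  shows "(\<forall>N. KN_exactly_observable M w n m F G H N \<longleftrightarrow>
              (\<forall>k. pos_def n (gramian n F G H (k + N) k)))
       \<and> (\<forall>P :: nat \<Rightarrow> real Matrix.mat.
            KWFT_exactly_observable M w n m F G H \<longrightarrow>
            (\<forall>k. pos_semidef n (P k)) \<longrightarrow>
            (\<forall>k. - P k + transpose_mat (F k) * P (Suc k) * F k
                   + transpose_mat (G k) * P (Suc k) * G k
                   + transpose_mat (H k) * H k = 0\<^sub>m n n) \<longrightarrow>
            (\<forall>k. pos_def n (P k)))"
proof -
  interpret stochastic_system M w n m F G H
    using assms(1,2,5-7)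
    by (intro stochastic_system.intro white_noise_space.intro white_noise_space_axioms.intro
      observed_system.intro)
  show ?thesis
  proof (intro conjI allI impI)
    fix N
    show "KN_exactly_observable M w n m F G H N \<longleftrightarrow>
        (\<forall>k. pos_def n (gramian n F G H (k + N) k))"
      unfolding KN_exactly_observable_def exactly_observable_iff
        pos_def_gramian_iff[OF le_add1] by (rule refl)
  next
    fix P :: "nat \<Rightarrow> real Matrix.mat" and k
    assume "KWFT_exactly_observable M w n m F G H"
    then obtain s where "exactly_observable_at M w n m F G H k s"
      unfolding KWFT_exactly_observable_def by blast
    note trivial = this[unfolded exactly_observable_iff, rule_format]
    assume P: "\<forall>k. pos_semidef n (P k)"
      and lyapunov: "\<forall>k. - P k + transpose_mat (F k) * P (Suc k) * F k
        + transpose_mat (G k) * P (Suc k) * G k + transpose_mat (H k) * H k = 0\<^sub>m n n"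
    have "v = 0\<^sub>v n" if "v \<in> carrier_vec n" "scalar_prod v (P k *\<^sub>v v) = 0" for v
      using trivial[OF that(1) lyapunov_null_vector_unobserved[OF spec[OF P] spec[OF lyapunov] that]] .
    with P[rule_format, of k] show "pos_def n (P k)"
      unfolding pos_semidef_def pos_def_def less_le by metis
  qed
qed

end
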